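(* Let $d(s)=T(s)-g_1^{(3)}(s)$. For all positive integers $s$, $d(s)=O(s \log s)$; that is, there is an absolute constant $C$ such that $|d(s)|\le C\, s\log s$ for all positive integers $s$.
   Context: $T(s)$ is the maximum number of directed (cyclic) triangles in a tournament on $s$ vertices. The function $g_1^{(3)}$ is defined recursively by $g_1^{(3)}(0)=g_1^{(3)}(1)=g_1^{(3)}(2)=0$ and, for $s\ge 3$, $$g_1^{(3)}(s)=\max_{a+b+c=s}\big(g_1^{(3)}(a)+g_1^{(3)}(b)+g_1^{(3)}(c)+abc\big),$$ where the maximum is over nonnegative integers $a,b,c<s$ with $a+b+c=s$. Here $\log$ is the natural logarithm. *)

theory Defs
  imports Complex_Main "Graph_Theory.Pair_Digraph"
begin

locale tournament = pair_digraph G for G :: "'a pair_pre_digraph" +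
  assumes exactly_one_arc:
    "\<lbrakk>u \<in> pverts G; v \<in> pverts G; u \<noteq> v\<rbrakk> \<Longrightarrow> (u, v) \<in> parcs G \<longleftrightarrow> (v, u) \<notin> parcs G"

text \<open>A directed triangle is recorded by its vertex set: three vertices of a tournament
  carry at most one directed triangle, and the absence of loops forces the three
  vertices to be distinct.\<close>

definition directed_triangles :: "'a pair_pre_digraph \<Rightarrow> 'a set set" where
  "directed_triangles G =
     {{u, v, w} | u v w. (u, v) \<in> parcs G \<and> (v, w) \<in> parcs G \<and> (w, u) \<in> parcs G}"

text \<open>Restricting to vertices in \<^typ>\<open>nat\<close> loses nothing, see \<open>T_upper\<close> and \<open>T_attained\<close> below;
  these also show that \<^const>\<open>Max\<close> is taken over a finite nonempty set.\<close>

definition T :: "nat \<Rightarrow> nat" where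
  "T s = Max {card (directed_triangles G) | G :: nat pair_pre_digraph.
                tournament G \<and> card (pverts G) = s}"

function g1 :: "nat \<Rightarrow> nat" where
  "g1 s = (if s < 3 then 0 else
     Max ((\<lambda>(a, b, c). g1 a + g1 b + g1 c + a * b * c) `
            {(a, b, c). a < s \<and> b < s \<and> c < s \<and> a + b + c = s}))"
  by pat_completeness auto
termination by (relation "measure id") auto

declare g1.simps [simp del]

definition d :: "nat \<Rightarrow> real" where
  "d s = real (T s) - real (g1 s)"

lemma directed_triangles_Pow:
  assumes "tournament G"
  shows "directed_triangles G \<subseteq> Pow (pverts G)"
proof -
  interpret tournament G by fact
  show ?thesis
    by (auto simp: directed_triangles_def dest: in_arcsD1 in_arcsD2)
qed

lemma finite_tournament_counts:
  "finite {card (directed_triangles G) | G :: nat pair_pre_digraph.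
             tournament G \<and> card (pverts G) = s}"
proof (rule finite_subset)
  show "{card (directed_triangles G) | G :: nat pair_pre_digraph.
          tournament G \<and> card (pverts G) = s} \<subseteq> {..2 ^ s}"
  proof (rule subsetI)
    fix n assume "n \<in> {card (directed_triangles G) | G :: nat pair_pre_digraph.
                        tournament G \<and> card (pverts G) = s}"
    then obtain G :: "nat pair_pre_digraph"
      where G: "tournament G" and n: "n = card (directed_triangles G)" "card (pverts G) = s"
      by blast
    interpret tournament G by (rule G)
    have "card (directed_triangles G) \<le> card (Pow (pverts G))"
      using directed_triangles_Pow[OF G] pair_finite_verts by (intro card_mono) auto
    then show "n \<in> {..2 ^ s}"
      by (simp add: n card_Pow pair_finite_verts)
  qed
qed simp

lemma ex_tournament:
  "\<exists>G :: nat pair_pre_digraph. tournament G \<and> card (pverts G) = s"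
proof (intro exI conjI)
  let ?G = "\<lparr>pverts = {..<s}, parcs = {(u, v). u < v \<and> v < s}\<rparr>"
  have "finite {(u, v). u < v \<and> v < s}"
    by (rule finite_subset[of _ "{..<s} \<times> {..<s}"]) auto
  then show "tournament ?G" by unfold_locales auto
  show "card (pverts ?G) = s" by simp
qed

lemma T_attained:
  "\<exists>G :: nat pair_pre_digraph.
     tournament G \<and> card (pverts G) = s \<and> card (directed_triangles G) = T s"
proof -
  have "T s \<in> {card (directed_triangles G) | G :: nat pair_pre_digraph.
                tournament G \<and> card (pverts G) = s}"
    unfolding T_def using finite_tournament_counts ex_tournament[of s] by (intro Max_in) auto
  then show ?thesis by auto
qed

lemma T_upper:
  fixes G :: "'a pair_pre_digraph"
  assumes "tournament G"
  shows "card (directed_triangles G) \<le> T (card (pverts G))"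
proof -
  interpret tournament G by fact
  obtain f :: "'a \<Rightarrow> nat" where inj: "inj_on f (pverts G)"
    using finite_imp_inj_to_nat_seg[OF pair_finite_verts] by blast
  define H where "H = \<lparr>pverts = f ` pverts G, parcs = map_prod f f ` parcs G\<rparr>"
  have H: "pverts H = f ` pverts G" "parcs H = map_prod f f ` parcs G"
    by (simp_all add: H_def)
  have arc: "(f u, f v) \<in> parcs H \<longleftrightarrow> (u, v) \<in> parcs G"
    if "u \<in> pverts G" "v \<in> pverts G" for u v
  proof
    assume "(f u, f v) \<in> parcs H"
    then obtain u' v' where e: "(u', v') \<in> parcs G" "f u = f u'" "f v = f v'"
      unfolding H(2) by auto
    then have "u = u'" "v = v'"
      using that inj_onD[OF inj] in_arcsD1[OF e(1)] in_arcsD2[OF e(1)] by simp_all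
    with e show "(u, v) \<in> parcs G" by simp
  qed (force simp: H(2))
  have tH: "tournament H"
  proof unfold_locales
    show "fst e \<in> pverts H" "snd e \<in> pverts H" "fst e \<noteq> snd e" if "e \<in> parcs H" for e
    proof -
      obtain u v where uv: "(u, v) \<in> parcs G" "e = (f u, f v)"
        using \<open>e \<in> parcs H\<close> unfolding H(2) by auto
      have "u \<in> pverts G" "v \<in> pverts G" "u \<noteq> v"
        using in_arcsD1[OF uv(1)] in_arcsD2[OF uv(1)] pair_no_loops[OF uv(1)] by simp_all
      then show "fst e \<in> pverts H" "snd e \<in> pverts H" "fst e \<noteq> snd e"
        using inj_onD[OF inj, of u v] by (auto simp: uv(2) H(1))
    qed
    show "finite (pverts H)" "finite (parcs H)"
      by (simp_all add: H pair_finite_verts pair_finite_arcs)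
    show "(x, y) \<in> parcs H \<longleftrightarrow> (y, x) \<notin> parcs H"
      if "x \<in> pverts H" "y \<in> pverts H" "x \<noteq> y" for x y
    proof -
      from that obtain u v where uv: "u \<in> pverts G" "v \<in> pverts G" "x = f u" "y = f v"
        unfolding H(1) by blast
      with \<open>x \<noteq> y\<close> have "u \<noteq> v" by blast
      then show ?thesis
        using exactly_one_arc[of u v] arc[of u v] arc[of v u] uv by simp
    qed
  qed
  have sub: "(`) f ` directed_triangles G \<subseteq> directed_triangles H"
  proof (rule image_subsetI)
    fix X assume "X \<in> directed_triangles G"
    then obtain u v w where X: "X = {u, v, w}"
      and a: "(u, v) \<in> parcs G" "(v, w) \<in> parcs G" "(w, u) \<in> parcs G"
      unfolding directed_triangles_def by blast
    then have "(f u, f v) \<in> parcs H" "(f v, f w) \<in> parcs H" "(f w, f u) \<in> parcs H"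
      unfolding H(2) by force+
    then show "f ` X \<in> directed_triangles H"
      unfolding directed_triangles_def X by auto
  qed
  have injf: "inj_on ((`) f) (directed_triangles G)"
    using inj_on_image_Pow[OF inj] directed_triangles_Pow[OF assms] by (rule inj_on_subset)
  have "finite (directed_triangles H)"
    using directed_triangles_Pow[OF tH]
    by (rule finite_subset) (simp add: H pair_finite_verts)
  then have "card (directed_triangles G) \<le> card (directed_triangles H)"
    using card_inj_on_le[OF injf sub] by blast
  also have "\<dots> \<le> T (card (pverts G))"
    unfolding T_def using tH card_image[OF inj]
    by (intro Max_ge finite_tournament_counts) (auto simp: H(1) intro!: exI[of _ H])
  finally show ?thesis .
qed

end

theory Submission
  imports Defs
begin

text \<open>Counting paths \<open>u \<rightarrow> v \<rightarrow> w\<close> by their middle vertex gives at most \<open>((s - 1) / 2)\<^sup>2\<close> per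
  vertex, while every triple of vertices carries at least one such path and every cyclic triple
  carries three. Hence \<open>T s \<le> (s\<^sup>3 - s) / 24\<close>. Splitting \<open>s\<close> as evenly as possible into three parts
  in the recursion for \<open>g1\<close> loses at most \<open>s / 4\<close> against \<open>(s\<^sup>3 - s) / 24\<close> on each of the
  logarithmically many levels. In the other direction \<open>g1 \<le> T\<close>, because substituting three
  tournaments into a cyclic triangle turns the recursion for \<open>g1\<close> into lower bounds for \<open>T\<close>.\<close>

section \<open>Upper bound for the number of directed triangles\<close>

lemma real_choose_three: "real (n choose 3) = real n * (real n - 1) * (real n - 2) / 6"
proof (induction n)
  case (Suc n)
  have "real (n choose 2) = real n * (real n - 1) / 2"
    by (cases n) (simp_all add: choose_two real_of_nat_div algebra_simps)
  with Suc show ?case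
    by (simp add: numeral_3_eq_3 numeral_2_eq_2 field_simps)
qed simp

context tournament
begin

text \<open>The ends need not be required to differ: \<open>u = w\<close> would give two opposite
  arcs, which \<open>arc_asym\<close> excludes.\<close>

definition two_paths :: "('a \<times> 'a \<times> 'a) set" where
  "two_paths = {(u, v, w). (u, v) \<in> parcs G \<and> (v, w) \<in> parcs G}"

text \<open>The fibres of \<open>two_paths\<close> over the vertex set of a path, hence disjoint for
  different \<open>X\<close>.\<close>

definition triple_paths :: "'a set \<Rightarrow> ('a \<times> 'a \<times> 'a) set" where
  "triple_paths X = {(u, v, w) \<in> two_paths. {u, v, w} = X}"

lemma arc_distinct: "(u, v) \<in> parcs G \<Longrightarrow> u \<noteq> v"
  using pair_no_loops[of "(u, v)"] by simp

lemma arc_asym: "(u, v) \<in> parcs G \<Longrightarrow> (v, u) \<notin> parcs G"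
  by (metis exactly_one_arc in_arcsD1 in_arcsD2 arc_distinct)

lemma finite_directed_triangles: "finite (directed_triangles G)"
  by (rule finite_subset[OF directed_triangles_Pow[OF tournament_axioms]]) (simp add: pair_finite_verts)

lemma finite_two_paths: "finite two_paths"
proof (rule finite_subset)
  show "two_paths \<subseteq> pverts G \<times> pverts G \<times> pverts G"
    by (auto simp: two_paths_def dest: in_arcsD1 in_arcsD2)
qed (simp add: pair_finite_verts)

lemma finite_triple_paths: "finite (triple_paths X)"
  by (rule finite_subset[OF _ finite_two_paths]) (auto simp: triple_paths_def)

text \<open>A path with middle vertex \<open>v\<close> is an in-neighbour together with an
  out-neighbour of \<open>v\<close>. The two degrees add up to \<open>s - 1\<close>, so four times
  their product is at most \<open>(s - 1)\<^sup>2\<close>.\<close>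

lemma card_two_paths_le:
  "4 * real (card two_paths) \<le> real (card (pverts G)) * (real (card (pverts G)) - 1)\<^sup>2"
proof -
  define s where "s = card (pverts G)"
  define I where "I v = {u. (u, v) \<in> parcs G}" for v
  define O' where "O' v = {w. (v, w) \<in> parcs G}" for v
  have sub: "I v \<subseteq> pverts G" "O' v \<subseteq> pverts G" for v
    by (auto simp: I_def O'_def dest: in_arcsD1 in_arcsD2)
  have fin: "finite (I v)" "finite (O' v)" for v
    by (rule finite_subset[OF sub(1) pair_finite_verts], rule finite_subset[OF sub(2) pair_finite_verts])
  have "two_paths = (\<Union>v\<in>pverts G. (\<lambda>(u, w). (u, v, w)) ` (I v \<times> O' v))"
    by (force simp: two_paths_def I_def O'_def dest: in_arcsD1 in_arcsD2)
  also have "card \<dots> = (\<Sum>v\<in>pverts G. card ((\<lambda>(u, w). (u, v, w)) ` (I v \<times> O' v)))"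
    using pair_finite_verts fin by (intro card_UN_disjoint) auto
  also have "\<dots> = (\<Sum>v\<in>pverts G. card (I v) * card (O' v))"
  proof (rule sum.cong[OF refl])
    fix v
    have "inj_on (\<lambda>(u, w). (u, v, w)) (I v \<times> O' v)"
      by (auto simp: inj_on_def)
    then show "card ((\<lambda>(u, w). (u, v, w)) ` (I v \<times> O' v)) = card (I v) * card (O' v)"
      by (simp add: card_image card_cartesian_product)
  qed
  finally have "4 * real (card two_paths) = (\<Sum>v\<in>pverts G. 4 * (real (card (I v)) * real (card (O' v))))"
    by (simp add: sum_distrib_left)
  also have "\<dots> \<le> (\<Sum>v\<in>pverts G. (real s - 1)\<^sup>2)"
  proof (rule sum_mono)
    fix v assume v: "v \<in> pverts G"
    have "I v \<union> O' v = pverts G - {v}"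
    proof (rule set_eqI)
      fix u
      show "u \<in> I v \<union> O' v \<longleftrightarrow> u \<in> pverts G - {v}"
        using sub[of v] exactly_one_arc[OF v, of u] arc_distinct[of u v] arc_distinct[of v u]
        by (auto simp: I_def O'_def)
    qed
    moreover have "I v \<inter> O' v = {}"
      using arc_asym by (auto simp: I_def O'_def)
    ultimately have "card (I v) + card (O' v) = s - 1"
      using card_Un_disjoint[OF fin, of v v] v pair_finite_verts by (simp add: s_def)
    \<comment> \<open>The degree sum was computed with truncated subtraction; positivity of
      \<open>s\<close> turns it into an equation between reals.\<close>
    moreover have "s \<ge> 1"
      using v pair_finite_verts card_gt_0_iff[of "pverts G"] by (auto simp: s_def)
    ultimately have "real s - 1 = real (card (I v)) + real (card (O' v))"
      by linarith
    then show "4 * (real (card (I v)) * real (card (O' v))) \<le> (real s - 1)\<^sup>2"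
      \<comment> \<open>The inequality \<open>4 x y \<le> (x + y)\<^sup>2\<close> is the
        nonnegativity of \<open>(x - y)\<^sup>2\<close>.\<close>
      using zero_le_power2[of "real (card (I v)) - real (card (O' v))"]
      by (simp add: power2_eq_square algebra_simps)
  qed
  finally show ?thesis
    by (simp add: s_def)
qed

text \<open>Without a path each of the three vertices would be a source or a sink of the triple. Two
  of them would be of the same sort, and the arc joining them contradicts this. The proof checks the
  orientations, with \<open>X\<close> written in all six orders.\<close>

lemma card_triple_paths_ge_1:
  assumes "X \<subseteq> pverts G" "card X = 3"
  shows "1 \<le> card (triple_paths X)"
proof -
  obtain x y z where X: "X = {x, y, z}" "x \<noteq> y" "y \<noteq> z" "x \<noteq> z"
    using assms(2) by (auto simp: card_3_iff)
  have arcs: "(x, y) \<in> parcs G \<or> (y, x) \<in> parcs G" "(y, z) \<in> parcs G \<or> (z, y) \<in> parcs G"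
    "(x, z) \<in> parcs G \<or> (z, x) \<in> parcs G"
    using exactly_one_arc[of x y] exactly_one_arc[of y z] exactly_one_arc[of x z] X assms(1) by auto
  have path: "triple_paths X \<noteq> {}" if "(u, v) \<in> parcs G" "(v, w) \<in> parcs G" "X = {u, v, w}" for u v w
    using that by (auto simp: triple_paths_def two_paths_def)
  have perms: "X = {x, y, z}" "X = {x, z, y}" "X = {y, x, z}" "X = {y, z, x}" "X = {z, x, y}" "X = {z, y, x}"
    unfolding X by auto
  have "triple_paths X \<noteq> {}"
    using arcs path[OF _ _ perms(1)] path[OF _ _ perms(2)] path[OF _ _ perms(3)]
      path[OF _ _ perms(4)] path[OF _ _ perms(5)] path[OF _ _ perms(6)] by argo
  then show ?thesis
    using finite_triple_paths by (simp add: Suc_le_eq card_gt_0_iff)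
qed

lemma card_directed_triangle:
  assumes "X \<in> directed_triangles G"
  shows "card X = 3"
proof -
  obtain u v w where X: "X = {u, v, w}"
    and a: "(u, v) \<in> parcs G" "(v, w) \<in> parcs G" "(w, u) \<in> parcs G"
    using assms unfolding directed_triangles_def by blast
  with arc_distinct[OF a(1)] arc_distinct[OF a(2)] arc_distinct[OF a(3)] show ?thesis
    by simp
qed

text \<open>Each vertex of the cycle is the middle of one path: the three rotations of
  \<open>(u, v, w)\<close>.\<close>

lemma card_triple_paths_ge_3:
  assumes "X \<in> directed_triangles G"
  shows "3 \<le> card (triple_paths X)"
proof -
  obtain u v w where X: "X = {u, v, w}"
    and a: "(u, v) \<in> parcs G" "(v, w) \<in> parcs G" "(w, u) \<in> parcs G"
    using assms unfolding directed_triangles_def by blast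
  have "u \<noteq> v" "v \<noteq> w" "w \<noteq> u"
    using arc_distinct[OF a(1)] arc_distinct[OF a(2)] arc_distinct[OF a(3)] by simp_all
  then have "3 = card {(u, v, w), (v, w, u), (w, u, v)}"
    by simp
  also have "\<dots> \<le> card (triple_paths X)"
    using a by (intro card_mono finite_triple_paths) (auto simp: triple_paths_def two_paths_def X)
  finally show ?thesis .
qed

text \<open>With \<open>t\<close> directed triangles, distributing the paths over triples gives
  \<open>(s choose 3) + 2 t \<le> s (s - 1)\<^sup>2 / 4\<close>. Solving for \<open>t\<close> leaves
  \<open>s (s - 1) (s + 1) / 24\<close>.\<close>

lemma card_directed_triangles_le:
  "real (card (directed_triangles G)) \<le> (real (card (pverts G)) ^ 3 - real (card (pverts G))) / 24"
proof -
  define s where "s = card (pverts G)"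
  define \<T> where "\<T> = {X. X \<subseteq> pverts G \<and> card X = 3}"
  have fin: "finite \<T>"
    using pair_finite_verts by (simp add: \<T>_def)
  have sub: "directed_triangles G \<subseteq> \<T>"
    using directed_triangles_Pow[OF tournament_axioms] card_directed_triangle
    by (auto simp: \<T>_def)
  have card\<T>: "card \<T> = s choose 3"
    using n_subsets[OF pair_finite_verts] by (simp add: \<T>_def s_def)
  \<comment> \<open>Each triple has weight 1, raised to 3 if it is cyclic; this is the guaranteed
    number of paths on it.\<close>
  have "(s choose 3) + 2 * card (directed_triangles G)
      = (\<Sum>X\<in>\<T>. 1 + (if X \<in> directed_triangles G then 2 else 0))"
    unfolding sum.distrib using fin sub by (simp add: card\<T> sum.If_cases inf.absorb2)
  also have "\<dots> \<le> (\<Sum>X\<in>\<T>. card (triple_paths X))"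
    using card_triple_paths_ge_1 card_triple_paths_ge_3 by (intro sum_mono) (auto simp: \<T>_def)
  also have "\<dots> = card (\<Union>X\<in>\<T>. triple_paths X)"
    using fin finite_triple_paths
    by (intro card_UN_disjoint[symmetric]) (auto simp: triple_paths_def)
  also have "\<dots> \<le> card two_paths"
    by (intro card_mono finite_two_paths) (auto simp: triple_paths_def)
  finally have "real (s choose 3) + 2 * real (card (directed_triangles G)) \<le> real (card two_paths)"
    by linarith
  with card_two_paths_le show ?thesis
    by (simp add: real_choose_three s_def[symmetric] power2_eq_square power3_eq_cube field_simps)
qed

end

lemma T_le: "real (T s) \<le> (real s ^ 3 - real s) / 24"
proof -
  obtain G :: "nat pair_pre_digraph"
    where "tournament G" "card (pverts G) = s" "card (directed_triangles G) = T s"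
    using T_attained by blast
  with tournament.card_directed_triangles_le[of G] show ?thesis
    by simp
qed

section \<open>Substitution into a cyclic triangle\<close>

definition cyclic_arcs :: "(nat \<times> nat) set" where
  "cyclic_arcs = {(0, 1), (1, 2), (2, 0)}"

lemma cyclic_arcs_exactly_one:
  assumes "i < 3" "j < 3" "i \<noteq> j"
  shows "(i, j) \<in> cyclic_arcs \<longleftrightarrow> (j, i) \<notin> cyclic_arcs"
proof -
  have "i = 0 \<or> i = 1 \<or> i = 2" "j = 0 \<or> j = 1 \<or> j = 2"
    using assms by linarith+
  with assms(3) show ?thesis
    by (elim disjE) (simp_all add: cyclic_arcs_def)
qed

text \<open>The blow-up of the cyclic triangle by three blocks. Tagging vertices with the block
  index keeps the blocks disjoint even if the given graphs share vertices.\<close>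

definition cyclic_substitution :: "(nat \<Rightarrow> 'a pair_pre_digraph) \<Rightarrow> (nat \<times> 'a) pair_pre_digraph" where
  "cyclic_substitution G =
     \<lparr>pverts = (SIGMA i:{..<3}. pverts (G i)),
      parcs = {((i, u), (j, v)). i < 3 \<and> j < 3 \<and> u \<in> pverts (G i) \<and> v \<in> pverts (G j) \<and>
                 (if i = j then (u, v) \<in> parcs (G i) else (i, j) \<in> cyclic_arcs)}\<rparr>"

lemma tournament_cyclic_substitution:
  assumes "\<And>i. i < 3 \<Longrightarrow> tournament (G i)"
  shows "tournament (cyclic_substitution G)"
proof -
  let ?V = "SIGMA i:{..<3}. pverts (G i)"
  have fin: "finite ?V"
    using assms by (auto intro!: finite_SigmaI pair_fin_digraph.pair_finite_verts
        simp: tournament_def pair_digraph_def)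
  have loop: "(u, u) \<notin> parcs (G i)" if "i < 3" for i u
    using tournament.arc_distinct[OF assms[OF that]] by blast
  have one: "(u, v) \<in> parcs (G i) \<longleftrightarrow> (v, u) \<notin> parcs (G i)"
    if "i < 3" "u \<in> pverts (G i)" "v \<in> pverts (G i)" "u \<noteq> v" for i u v
    using tournament.exactly_one_arc[OF assms] that by blast
  have sub: "parcs (cyclic_substitution G) \<subseteq> ?V \<times> ?V"
    by (auto simp: cyclic_substitution_def)
  show ?thesis
  proof unfold_locales
    show "finite (pverts (cyclic_substitution G))" "finite (parcs (cyclic_substitution G))"
      using fin finite_subset[OF sub] by (simp_all add: cyclic_substitution_def)
    fix e assume e: "e \<in> parcs (cyclic_substitution G)"
    then show "fst e \<in> pverts (cyclic_substitution G)" "snd e \<in> pverts (cyclic_substitution G)"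
      using sub by (auto simp: cyclic_substitution_def)
    from e loop show "fst e \<noteq> snd e"
      by (auto simp: cyclic_substitution_def)
  next
    fix x y
    assume xy: "x \<in> pverts (cyclic_substitution G)" "y \<in> pverts (cyclic_substitution G)" "x \<noteq> y"
    obtain i u j v where [simp]: "x = (i, u)" "y = (j, v)"
      by (metis surj_pair)
    have ij: "i < 3" "j < 3" "u \<in> pverts (G i)" "v \<in> pverts (G j)" "i = j \<Longrightarrow> u \<noteq> v"
      using xy by (auto simp: cyclic_substitution_def)
    show "(x, y) \<in> parcs (cyclic_substitution G) \<longleftrightarrow> (y, x) \<notin> parcs (cyclic_substitution G)"
    proof (cases "i = j")
      case True
      then show ?thesis
        using ij one[of i u v] by (simp add: cyclic_substitution_def)
    next
      case False
      then show ?thesis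
        using ij cyclic_arcs_exactly_one[of i j] by (simp add: cyclic_substitution_def)
    qed
  qed
qed

text \<open>Substitute optimal tournaments for the three blocks. The triangles inside the blocks
  survive (\<open>D i\<close>), and every choice of one vertex per block is a new triangle
  (\<open>M\<close>), since arcs between blocks run 0 to 1 to 2 to 0.\<close>

lemma T_superadditive: "T a + T b + T c + a * b * c \<le> T (a + b + c)"
proof -
  obtain A B C :: "nat pair_pre_digraph"
    where A: "tournament A" "card (pverts A) = a" "card (directed_triangles A) = T a"
      and B: "tournament B" "card (pverts B) = b" "card (directed_triangles B) = T b"
      and C: "tournament C" "card (pverts C) = c" "card (directed_triangles C) = T c"
    using T_attained by metis
  define G where "G i = (if i = 0 then A else if i = 1 then B else C)" for i :: nat
  let ?H = "cyclic_substitution G"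
  have tG: "tournament (G i)" for i
    using A B C by (simp add: G_def)
  then have tH: "tournament ?H"
    by (rule tournament_cyclic_substitution)
  have finV: "finite (pverts (G i))" for i
    using tG by (auto simp: tournament_def pair_digraph_def
        intro: pair_fin_digraph.pair_finite_verts)
  have cardH: "card (pverts ?H) = a + b + c"
    using finV A B C
    by (simp add: cyclic_substitution_def card_SigmaI G_def numeral_3_eq_3 lessThan_Suc)
  define D where "D i = (`) (Pair i) ` directed_triangles (G i)" for i
  define M where "M = (\<lambda>(u, v, w). {(0::nat, u), (1, v), (2, w)}) ` (pverts A \<times> pverts B \<times> pverts C)"
  have cardD: "card (D i) = card (directed_triangles (G i))" for i
    unfolding D_def by (intro card_image) (auto simp: inj_on_def inj_image_eq_iff)
  have cardM: "card M = a * b * c"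
  proof -
    have "inj_on (\<lambda>(u, v, w). {(0::nat, u), (1, v), (2, w)}) (pverts A \<times> pverts B \<times> pverts C)"
    proof (rule inj_onI)
      fix p q :: "nat \<times> nat \<times> nat"
      assume pq: "(\<lambda>(u, v, w). {(0::nat, u), (1, v), (2, w)}) p = (\<lambda>(u, v, w). {(0, u), (1, v), (2, w)}) q"
      obtain u v w u' v' w' where uvw: "p = (u, v, w)" "q = (u', v', w')"
        by (metis prod_cases3)
      have eq: "{(0::nat, u), (1, v), (2, w)} = {(0, u'), (1, v'), (2, w')}"
        using pq by (simp only: uvw prod.case)
      have "(0, u) \<in> {(0::nat, u'), (1, v'), (2, w')}" "(1, v) \<in> {(0::nat, u'), (1, v'), (2, w')}"
        "(2, w) \<in> {(0::nat, u'), (1, v'), (2, w')}"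
        unfolding eq[symmetric] by simp_all
      then show "p = q"
        by (simp add: uvw)
    qed
    then show ?thesis
      using A B C by (simp add: M_def card_image card_cartesian_product)
  qed
  \<comment> \<open>The set of block indices met by a triangle separates the families
    \<open>D 0\<close>, \<open>D 1\<close>, \<open>D 2\<close> and \<open>M\<close>, so their sizes
    add.\<close>
  have fstD: "fst ` X = {i}" if "X \<in> D i" for X i
    using that by (auto simp: D_def directed_triangles_def)
  have fstM: "fst ` X = {0, 1, 2}" if "X \<in> M" for X
    using that by (auto simp: M_def)
  have fin: "finite (directed_triangles (G i))" for i
    using tG by (rule tournament.finite_directed_triangles)
  then have finD: "finite (D i)" for i
    by (simp add: D_def)
  have disjD: "D i \<inter> D j = {}" if "i \<noteq> j" for i j
  proof (rule equals0I)
    fix X assume "X \<in> D i \<inter> D j"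
    then have "{i} = {j}"
      using fstD[of X i] fstD[of X j] by simp
    with that show False by simp
  qed
  have disjM: "D i \<inter> M = {}" for i
  proof (rule equals0I)
    fix X assume "X \<in> D i \<inter> M"
    then have "card {i} = card {0::nat, 1, 2}"
      using fstD[of X i] fstM[of X] by (metis IntD1 IntD2)
    then show False by simp
  qed
  have "finite M"
    using finV[of 0] finV[of 1] finV[of 2] by (simp add: M_def G_def)
  moreover have "D 0 \<inter> D 1 = {}" "(D 0 \<union> D 1) \<inter> D 2 = {}" "(D 0 \<union> D 1 \<union> D 2) \<inter> M = {}"
    by (simp_all add: Int_Un_distrib2 disjD disjM)
  ultimately have "card (D 0 \<union> D 1 \<union> D 2 \<union> M) = T a + T b + T c + a * b * c"
    using finD A B C by (simp add: card_Un_disjoint cardD cardM) (simp add: G_def)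
  moreover have "D i \<subseteq> directed_triangles ?H" if "i < 3" for i
  proof
    fix X assume "X \<in> D i"
    then obtain u v w where X: "X = {(i, u), (i, v), (i, w)}"
      and a: "(u, v) \<in> parcs (G i)" "(v, w) \<in> parcs (G i)" "(w, u) \<in> parcs (G i)"
      by (auto simp: D_def directed_triangles_def)
    then have "{u, v, w} \<subseteq> pverts (G i)"
      using directed_triangles_Pow[OF tG, of i] by (auto simp: directed_triangles_def)
    with a that have "((i, u), (i, v)) \<in> parcs ?H" "((i, v), (i, w)) \<in> parcs ?H"
      "((i, w), (i, u)) \<in> parcs ?H"
      by (simp_all add: cyclic_substitution_def)
    then show "X \<in> directed_triangles ?H"
      unfolding directed_triangles_def X by blast
  qed
  moreover have "M \<subseteq> directed_triangles ?H"
  proof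
    fix X assume "X \<in> M"
    then obtain u v w where X: "X = {(0, u), (1, v), (2, w)}"
      and "u \<in> pverts A" "v \<in> pverts B" "w \<in> pverts C"
      by (auto simp: M_def)
    then have "((0, u), (1, v)) \<in> parcs ?H" "((1, v), (2, w)) \<in> parcs ?H" "((2, w), (0, u)) \<in> parcs ?H"
      by (simp_all add: cyclic_substitution_def cyclic_arcs_def G_def)
    then show "X \<in> directed_triangles ?H"
      unfolding directed_triangles_def X by blast
  qed
  moreover have "finite (directed_triangles ?H)"
    using tH by (rule tournament.finite_directed_triangles)
  ultimately have "T a + T b + T c + a * b * c \<le> card (directed_triangles ?H)"
    using card_mono[of "directed_triangles ?H" "D 0 \<union> D 1 \<union> D 2 \<union> M"] by simp
  with T_upper[OF tH] cardH show ?thesis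
    by simp
qed

section \<open>The recursion\<close>

lemma finite_g1_splits: "finite {(a, b, c). a < s \<and> b < s \<and> c < s \<and> a + b + c = (s::nat)}"
  by (rule finite_subset[of _ "{..<s} \<times> {..<s} \<times> {..<s}"]) auto

lemma g1_ge:
  assumes "a < s" "b < s" "c < s" "a + b + c = s" "3 \<le> s"
  shows "g1 a + g1 b + g1 c + a * b * c \<le> g1 s"
  using assms finite_g1_splits[of s]
  by (subst (4) g1.simps) (auto intro!: Max_ge rev_image_eqI[of "(a, b, c)"])

lemma g1_attained:
  assumes "3 \<le> s"
  obtains a b c where "a < s" "b < s" "c < s" "a + b + c = s"
    "g1 s = g1 a + g1 b + g1 c + a * b * c"
proof -
  let ?S = "{(a, b, c). a < s \<and> b < s \<and> c < s \<and> a + b + c = s}"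
  \<comment> \<open>One admissible split suffices: it makes the set nonempty, so the maximum is
    attained.\<close>
  have "(1, 1, s - 2) \<in> ?S"
    using assms by auto
  then have "g1 s \<in> (\<lambda>(a, b, c). g1 a + g1 b + g1 c + a * b * c) ` ?S"
    using assms finite_g1_splits[of s] by (subst g1.simps) (auto simp del: mem_Collect_eq intro!: Max_in)
  then show thesis
    using that by auto
qed

text \<open>An optimal split for \<open>g1 s\<close> is also a substitution for tournaments, so
  \<open>T_superadditive\<close> closes the induction. Hence \<open>d\<close> is
  nonnegative.\<close>

lemma g1_le_T: "g1 s \<le> T s"
proof (induction s rule: less_induct)
  case (less s)
  show ?case
  proof (cases "s < 3")
    case True
    then show ?thesis by (simp add: g1.simps)
  next
    case False
    then obtain a b c where "a < s" "b < s" "c < s" "a + b + c = s"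
      "g1 s = g1 a + g1 b + g1 c + a * b * c"
      using g1_attained[of s] by auto
    with less[of a] less[of b] less[of c] T_superadditive[of a b c] show ?thesis
      by simp
  qed
qed

text \<open>The parts are as equal as possible. For \<open>s = 3 k\<close>, \<open>3 k + 1\<close>,
  \<open>3 k + 2\<close> the exact loss is \<open>0\<close>, \<open>k / 4\<close>,
  \<open>(k + 1) / 4\<close>, each at most \<open>s / 4\<close>.\<close>

lemma cube_defect_split:
  fixes s :: nat
  defines "f \<equiv> \<lambda>n::nat. (real n ^ 3 - real n) / 24"
  obtains a b c where "a + b + c = s" "3 * a \<le> s + 2" "3 * b \<le> s + 2" "3 * c \<le> s + 2"
    "f s \<le> f a + f b + f c + real (a * b * c) + real s / 4"
proof -
  define k where "k = s div 3"
  consider "s = 3 * k" | "s = 3 * k + 1" | "s = 3 * k + 2"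
    unfolding k_def by linarith
  then show thesis
  proof cases
    case 1
    then show thesis
      by (intro that[of k k k]) (auto simp: f_def power3_eq_cube field_simps)
  next
    case 2
    then show thesis
      by (intro that[of k k "k + 1"]) (auto simp: f_def power3_eq_cube field_simps)
  next
    case 3
    then show thesis
      by (intro that[of k "k + 1" "k + 1"]) (auto simp: f_def power3_eq_cube field_simps)
  qed
qed

text \<open>The near-equal split is one candidate in the maximum defining \<open>g1 s\<close>. It
  loses at most \<open>s / 4\<close>, while passing to parts of size at most
  \<open>(s + 2) / 3\<close> lowers the logarithm by at least \<open>1 / 4\<close>, which pays for
  the loss.\<close>

lemma g1_lower: "(real s ^ 3 - real s) / 24 - real (g1 s) \<le> real s * ln (real s)"
proof (induction s rule: less_induct)
  case (less s)
  consider "s = 0" | "s = 1" | "s = 2" | "3 \<le> s"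
    by linarith
  then show ?case
  proof cases
    case 3
    \<comment> \<open>The claim is \<open>1 / 4 \<le> 2 ln 2\<close>; the bound
      \<open>ln (1 / 2) \<le> - 1 / 2\<close> gives \<open>ln 2 \<ge> 1 / 2\<close>.\<close>
    then show ?thesis
      using ln_ge_iff[of 2 "1 - 1 / 2"] ln_le_minus_one[of "1 / 2 :: real"]
      by (simp add: g1.simps ln_div)
  next
    case 4
    define f where "f n = (real n ^ 3 - real n) / 24" for n :: nat
    obtain a b c where abc: "a + b + c = s" "3 * a \<le> s + 2" "3 * b \<le> s + 2" "3 * c \<le> s + 2"
      "f s \<le> f a + f b + f c + real (a * b * c) + real s / 4"
      using cube_defect_split[of s] unfolding f_def by blast
    define L where "L = ln ((real s + 2) / 3)"
    have part: "f n - real (g1 n) \<le> real n * L" if "3 * n \<le> s + 2" for n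
    proof (cases "n = 0")
      case False
      \<comment> \<open>From \<open>3 n \<le> s + 2\<close> and \<open>3 \<le> s\<close> it follows
        that \<open>n < s\<close>, so the induction hypothesis applies.\<close>
      have "f n - real (g1 n) \<le> real n * ln (real n)"
        using less[of n] that 4 by (simp add: f_def)
      also have "\<dots> \<le> real n * L"
        unfolding L_def using False that by (intro mult_left_mono) (auto intro!: ln_mono)
      finally show ?thesis .
    qed (simp add: f_def)
    have "real (g1 a + g1 b + g1 c + a * b * c) \<le> real (g1 s)"
      using g1_ge[of a s b c] abc 4 by linarith
    then have "f s - real (g1 s) \<le> real a * L + real b * L + real c * L + real s / 4"
      using part[OF abc(2)] part[OF abc(3)] part[OF abc(4)] abc(5) by simp
    also have "\<dots> = real s * (L + 1 / 4)"
      using abc(1) by (auto simp: algebra_simps)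
    also have "\<dots> \<le> real s * ln (real s)"
    proof (rule mult_left_mono)
      have "L - ln (real s) = ln ((real s + 2) / 3 / real s)"
        unfolding L_def using 4 by (subst ln_div) auto
      also have "\<dots> \<le> (real s + 2) / 3 / real s - 1"
        using 4 by (intro ln_le_minus_one) simp
      \<comment> \<open>The left side equals \<open>2 / (3 s) - 2 / 3\<close>, which is at most
        \<open>- 4 / 9\<close> for \<open>s \<ge> 3\<close>.\<close>
      also have "\<dots> \<le> - 1 / 4"
        using 4 by (simp add: field_simps)
      finally show "L + 1 / 4 \<le> ln (real s)"
        by simp
    qed simp
    finally show ?thesis
      by (simp add: f_def)
  qed simp_all
qed

theorem proposition5p5:
  shows "\<exists>C::real. \<forall>s::nat. s \<ge> 1 \<longrightarrow> \<bar>d s\<bar> \<le> C * (real s * ln (real s))"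
\<comment> \<open>\<open>C = 1\<close> works: \<open>0 \<le> T s - g1 s \<le> (s\<^sup>3 - s) / 24 -
  g1 s \<le> s ln s\<close>. At \<open>s = 1\<close> the bound is 0.\<close>
proof (intro exI[of _ 1] allI impI)
  fix s :: nat
  show "\<bar>d s\<bar> \<le> 1 * (real s * ln (real s))"
    using T_le[of s] g1_lower[of s] g1_le_T[of s] unfolding d_def by linarith
qed

end
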